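(* Let $m,n\geq2$, $d,t\geq0$, and $j\geq1$. Then the number of Fibonacci polyominoes $P\in\mathcal F_{m,n}$ with $\operatorname{des}(P)=d$, $\operatorname{lmin}(P)=j$ and $\operatorname{lev}(P)=t$ equals \[ S_{m,n-m-1}(d,j,t)+S_{m-1,n-m}(d-1,j-1,t). \]
   Context: A Fibonacci polyomino is a (nonempty) polyomino, considered up to translation, that is column-convex (each column is a contiguous segment of unit cells) and such that, reading columns from left to right, the bottom cell of each column lies exactly one unit above the bottom cell of the preceding column. Equivalently, it is given by a sequence of column heights $(h_1,\dots,h_m)$, $m\ge 1$, with $h_i\ge 2$ for $1\le i\le m-1$ and $h_m\ge 1$; column $i$ consists of the cells in column position $i$ and rows $i,i+1,\dots,i+h_i-1$. The horizontal (resp. vertical) semiperimeter is half the number of horizontal (resp. vertical) unit edges on the boundary (edges belonging to exactly one cell). $\mathcal F_{m,n}$ is the set of Fibonacci polyominoes with horizontal semiperimeter $m$ (equivalently $m$ columns) and vertical semiperimeter $n$. For $P$ with column heights $(h_1,\ldots,h_m)$: $\operatorname{des}(P)=|\{i:1\le i<m,\ h_i>h_{i+1}\}|$; $\operatorname{lev}(P)=|\{i:1\le i<m,\ h_i=h_{i+1}\}|$; $\operatorname{lmin}(P)$ is the number of columns $i$ such that $i=1$ or $h_i<\min\{h_1,\ldots,h_{i-1}\}$. Write $(n)_+=\max\{n,0\}$. For a sequence $\mathbf a=(a_1,\ldots,a_\ell)$ of nonnegative integers: $\operatorname{exc}(\mathbf a)=a_1+\sum_{j=2}^{\ell}(a_j-a_{j-1}-1)_+$;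 $\operatorname{asc}(\mathbf a)=|\{j:1\le j<\ell,\ a_j<a_{j+1}\}|$; $\operatorname{lev}(\mathbf a)=|\{j:1\le j<\ell,\ a_j=a_{j+1}\}|$; $\operatorname{rlmin}(\mathbf a)$ is the number of indices $i$ with $a_i<a_j$ for all $j>i$. For $\ell\ge1$, $S_{\ell,r}(d,j,t)$ is the number of sequences $\mathbf a$ of $\ell$ nonnegative integers with $\operatorname{exc}(\mathbf a)=r$, $\operatorname{asc}(\mathbf a)=d$, $\operatorname{rlmin}(\mathbf a)=j$, $\operatorname{lev}(\mathbf a)=t$; it is $0$ whenever a parameter is outside its natural range, in particular when $r<0$, $d<0$, $j<0$ or $t<0$. *)

theory Defs
  imports Complex_Main
begin

text \<open>The pair \<open>(x, y)\<close> is the unit cell \<open>[x, x + 1] \<times> [y, y + 1]\<close>,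
  in column \<open>x\<close> and row \<open>y\<close>.\<close>
type_synonym cell = "int \<times> int"

definition adjacent :: "cell \<Rightarrow> cell \<Rightarrow> bool" where
  "adjacent c c' \<longleftrightarrow> \<bar>fst c - fst c'\<bar> + \<bar>snd c - snd c'\<bar> = 1"

definition polyomino :: "cell set \<Rightarrow> bool" where
  "polyomino P \<longleftrightarrow> finite P \<and> P \<noteq> {} \<and>
     (\<forall>c\<in>P. \<forall>c'\<in>P. (c, c') \<in> {(a, b). a \<in> P \<and> b \<in> P \<and> adjacent a b}\<^sup>*)"

definition column :: "cell set \<Rightarrow> int \<Rightarrow> int set" where
  "column P x = {y. (x, y) \<in> P}"

definition column_convex :: "cell set \<Rightarrow> bool" where
  "column_convex P \<longleftrightarrow>
     (\<forall>x. \<forall>y\<in>column P x. \<forall>y'\<in>column P x. {y..y'} \<subseteq> column P x)"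

text \<open>The nonempty columns of a polyomino occupy consecutive positions, so the column
  preceding column \<open>x + 1\<close> is column \<open>x\<close>.\<close>
definition fibonacci_polyomino :: "cell set \<Rightarrow> bool" where
  "fibonacci_polyomino P \<longleftrightarrow> polyomino P \<and> column_convex P \<and>
     (\<forall>x. column P x \<noteq> {} \<and> column P (x + 1) \<noteq> {} \<longrightarrow>
        Min (column P (x + 1)) = Min (column P x) + 1)"

definition translation :: "(cell set \<times> cell set) set" where
  "translation = {(P, Q). \<exists>u v. Q = (\<lambda>(x, y). (x + u, y + v)) ` P}"

text \<open>A unit edge is named by its left end point if it is horizontal and by its lower
  end point if it is vertical.\<close>
definition horizontal_edges :: "cell \<Rightarrow> (int \<times> int) set" where
  "horizontal_edges c = {(fst c, snd c), (fst c, snd c + 1)}"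

definition vertical_edges :: "cell \<Rightarrow> (int \<times> int) set" where
  "vertical_edges c = {(fst c, snd c), (fst c + 1, snd c)}"

definition horizontal_semiperimeter :: "cell set \<Rightarrow> rat" where
  "horizontal_semiperimeter P = of_nat (card {e. \<exists>!c. c \<in> P \<and> e \<in> horizontal_edges c}) / 2"

definition vertical_semiperimeter :: "cell set \<Rightarrow> rat" where
  "vertical_semiperimeter P = of_nat (card {e. \<exists>!c. c \<in> P \<and> e \<in> vertical_edges c}) / 2"

text \<open>Concrete cell sets, not yet identified up to translation.\<close>
definition fibonacci_polyominoes :: "nat \<Rightarrow> nat \<Rightarrow> cell set set" where
  "fibonacci_polyominoes m n = {P. fibonacci_polyomino P \<and>
     horizontal_semiperimeter P = of_nat m \<and> vertical_semiperimeter P = of_nat n}"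

definition column_heights :: "cell set \<Rightarrow> nat list" where
  "column_heights P = map (\<lambda>x. card (column P x)) (sorted_list_of_set (fst ` P))"

text \<open>Sequences are lists, so all indices below are shifted to start at 0.\<close>
definition des :: "nat list \<Rightarrow> nat" where
  "des h = card {i. Suc i < length h \<and> h ! i > h ! Suc i}"

definition asc :: "nat list \<Rightarrow> nat" where
  "asc a = card {i. Suc i < length a \<and> a ! i < a ! Suc i}"

definition lev :: "nat list \<Rightarrow> nat" where
  "lev a = card {i. Suc i < length a \<and> a ! i = a ! Suc i}"

definition lmin :: "nat list \<Rightarrow> nat" where
  "lmin h = card {i. i < length h \<and> (i = 0 \<or> h ! i < Min {h ! k | k. k < i})}"

definition rlmin :: "nat list \<Rightarrow> nat" where
  "rlmin a = card {i. i < length a \<and> (\<forall>k. i < k \<and> k < length a \<longrightarrow> a ! i < a ! k)}"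

definition exc :: "nat list \<Rightarrow> int" where
  "exc a = int (a ! 0) + (\<Sum>i = 1..<length a. max (int (a ! i) - int (a ! (i - 1)) - 1) 0)"

text \<open>Integer parameters: outside the natural range, in particular for a negative
  parameter, no sequence qualifies and the value is 0.\<close>
definition S :: "nat \<Rightarrow> int \<Rightarrow> int \<Rightarrow> int \<Rightarrow> int \<Rightarrow> nat" where
  "S l r d j t = card {a :: nat list. length a = l \<and> exc a = r \<and>
     int (asc a) = d \<and> int (rlmin a) = j \<and> int (lev a) = t}"

lemma equiv_translation: "equiv UNIV translation"
proof (intro equivI refl_onI symI transI)
  show "(P, P) \<in> translation" for P
    unfolding translation_def by (auto intro!: exI[of _ 0])
  show "(Q, P) \<in> translation" if "(P, Q) \<in> translation" for P Q
  proof -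
    from that obtain u v where "Q = (\<lambda>(x, y). (x + u, y + v)) ` P"
      unfolding translation_def by auto
    then have "P = (\<lambda>(x, y). (x + - u, y + - v)) ` Q"
      by (simp add: image_image case_prod_unfold)
    then show ?thesis unfolding translation_def by blast
  qed
  show "(P, R) \<in> translation" if "(P, Q) \<in> translation" "(Q, R) \<in> translation" for P Q R
  proof -
    from that obtain u v u' v' where "Q = (\<lambda>(x, y). (x + u, y + v)) ` P"
      and "R = (\<lambda>(x, y). (x + u', y + v')) ` Q"
      unfolding translation_def by auto
    then have "R = (\<lambda>(x, y). (x + (u + u'), y + (v + v'))) ` P"
      by (simp add: image_image case_prod_unfold add.assoc)
    then show ?thesis unfolding translation_def by blast
  qed
qed auto

end

theory Submission imports Defs begin

text \<open>
  Up to translation a Fibonacci polyomino is its list \<open>h\<close> of column heights. The boundary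
  between columns \<open>i\<close> and \<open>i + 1\<close> has one vertical edge at the bottom and
  \<open>\<bar>x\<bar>\<close> edges at the top, where \<open>x = h\<^sub>i - h\<^sub>i\<^sub>+\<^sub>1 - 1\<close>. Writing
  \<open>\<bar>x\<bar> = 2 max x 0 - x\<close> and telescoping, the vertical semiperimeter is \<open>exc (rev h) + m - 1\<close>.
  Reversal turns \<open>des\<close> into \<open>asc\<close> and \<open>lmin\<close> into \<open>rlmin\<close>. If the last height is at
  least 2, subtracting 2 everywhere gives the first summand; if it is 1, it is a strict minimum
  preceded by a descent, and deleting it before subtracting 2 gives the second.
\<close>

section \<open>Statistics of sequences\<close>

lemma asc_rev: "asc (rev h) = des h"
  unfolding asc_def des_def
proof (rule bij_betw_same_card)
  \<comment> \<open>Adjacent positions \<open>i\<close> and \<open>i + 1\<close> of the reversal are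
    positions \<open>length h - 1 - i\<close> and \<open>length h - 2 - i\<close> of
    \<open>h\<close>; the smaller one names the pair.\<close>
  show "bij_betw (\<lambda>i. length h - 2 - i) {i. Suc i < length (rev h) \<and> rev h ! i < rev h ! Suc i}
    {i. Suc i < length h \<and> h ! Suc i < h ! i}"
    by (rule bij_betw_byWitness[where f' = "\<lambda>i. length h - 2 - i"])
      (auto simp: rev_nth Suc_diff_Suc numeral_2_eq_2)
qed

lemma lev_rev: "lev (rev h) = lev h"
  unfolding lev_def
proof (rule bij_betw_same_card)
  show "bij_betw (\<lambda>i. length h - 2 - i) {i. Suc i < length (rev h) \<and> rev h ! i = rev h ! Suc i}
    {i. Suc i < length h \<and> h ! i = h ! Suc i}"
    by (rule bij_betw_byWitness[where f' = "\<lambda>i. length h - 2 - i"])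
      (auto simp: rev_nth Suc_diff_Suc numeral_2_eq_2)
qed

lemma rlmin_rev: "rlmin (rev h) = lmin h"
proof -
  let ?n = "length h"
  \<comment> \<open>At \<open>i = 0\<close> the minimum would be over the empty set, where
    \<open>Min\<close> is unspecified; the disjunct \<open>i = 0\<close> agrees with the vacuous
    truth on the right.\<close>
  have *: "(i = 0 \<or> h ! i < Min {h ! k | k. k < i}) \<longleftrightarrow> (\<forall>k<i. h ! i < h ! k)" for i
  proof (cases "i = 0")
    case False
    then have "{h ! k | k. k < i} \<noteq> {}" by auto
    then have "h ! i < Min {h ! k | k. k < i} \<longleftrightarrow> (\<forall>k<i. h ! i < h ! k)"
      by (subst Min_gr_iff) auto
    with False show ?thesis by simp
  qed simp
  have "card {i. i < length (rev h) \<and> (\<forall>k. i < k \<and> k < length (rev h) \<longrightarrow> rev h ! i < rev h ! k)} =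
    card {i. i < ?n \<and> (\<forall>k<i. h ! i < h ! k)}"
  proof (rule bij_betw_same_card, rule bij_betw_byWitness)
    show "(\<lambda>i. ?n - 1 - i) ` {i. i < length (rev h) \<and> (\<forall>k. i < k \<and> k < length (rev h) \<longrightarrow> rev h ! i < rev h ! k)}
      \<subseteq> {i. i < ?n \<and> (\<forall>k<i. h ! i < h ! k)}"
    proof (intro image_subsetI, unfold mem_Collect_eq length_rev, elim conjE, intro conjI allI impI)
      fix i k assume i: "i < ?n" and A: "\<forall>k. i < k \<and> k < ?n \<longrightarrow> rev h ! i < rev h ! k"
        and "k < ?n - 1 - i"
      then have "i < ?n - 1 - k \<and> ?n - 1 - k < ?n" "k < ?n" by auto
      then show "h ! (?n - 1 - i) < h ! k"
        using A[rule_format, of "?n - 1 - k"] i by (simp add: rev_nth)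
    qed auto
    show "(\<lambda>i. ?n - 1 - i) ` {i. i < ?n \<and> (\<forall>k<i. h ! i < h ! k)} \<subseteq>
      {i. i < length (rev h) \<and> (\<forall>k. i < k \<and> k < length (rev h) \<longrightarrow> rev h ! i < rev h ! k)}"
      by (auto simp: rev_nth)
  qed auto
  then show ?thesis unfolding rlmin_def lmin_def * .
qed

text \<open>A rise in the reversal is a drop in \<open>h\<close>, and the first entry of the
  reversal is \<open>last h\<close>. The shift between \<open>{1..<n}\<close> and
  \<open>{..<n - 1}\<close> comes from naming a pair by its right or by its left member.\<close>

lemma exc_rev:
  assumes "h \<noteq> []"
  shows "exc (rev h) = int (last h) +
    (\<Sum>i<length h - 1. max (int (h ! i) - int (h ! Suc i) - 1) 0)"
proof -
  have "(\<Sum>i = 1..<length (rev h). max (int (rev h ! i) - int (rev h ! (i - 1)) - 1) 0) =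
    (\<Sum>i<length h - 1. max (int (h ! i) - int (h ! Suc i) - 1) 0)"
    by (rule sum.reindex_bij_witness[of _ "\<lambda>i. length h - 1 - i" "\<lambda>i. length h - 1 - i"])
      (auto simp: rev_nth Suc_diff_Suc)
  then show ?thesis using assms by (simp add: exc_def rev_nth last_conv_nth)
qed

section \<open>Shifting all entries and prepending one\<close>

lemma asc_map_add: "asc (map (\<lambda>x. x + c) a) = asc a"
  unfolding asc_def by (rule arg_cong[where f = card]) auto

lemma lev_map_add: "lev (map (\<lambda>x. x + c) a) = lev a"
  unfolding lev_def by (rule arg_cong[where f = card]) auto

lemma rlmin_map_add: "rlmin (map (\<lambda>x. x + c) a) = rlmin a"
  unfolding rlmin_def by (rule arg_cong[where f = card]) auto

text \<open>The shift cancels in every difference and survives only in the first entry.\<close>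

lemma exc_map_add: "a \<noteq> [] \<Longrightarrow> exc (map (\<lambda>x. x + c) a) = exc a + int c"
  unfolding exc_def by (auto intro!: sum.cong)

text \<open>Index 0 is the prepended entry and the successors are the indices of the tail; the
  recursions for \<open>x # b\<close> below come from this split.\<close>

lemma card_Collect_nat_split:
  assumes "finite {i. P (Suc i)}"
  shows "card {i. P i} = (if P 0 then 1 else 0) + card {i. P (Suc i)}"
proof -
  have *: "{i. P i} = {i. i = 0 \<and> P 0} \<union> Suc ` {i. P (Suc i)}"
    by (auto simp: image_iff) (metis not0_implies_Suc)+
  show ?thesis unfolding *
    by (subst card_Un_disjoint) (use assms in \<open>auto simp: card_image\<close>)
qed

lemma finite_Collect_Suc_less: "finite {i. Suc i < k \<and> P i}"
  by (rule finite_subset[of _ "{..<k}"]) auto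

lemma asc_Cons:
  assumes "b \<noteq> []"
  shows "asc (x # b) = (if x < b ! 0 then 1 else 0) + asc b"
  unfolding asc_def using assms by (subst card_Collect_nat_split) (auto simp: finite_Collect_Suc_less)

lemma lev_Cons:
  assumes "b \<noteq> []"
  shows "lev (x # b) = (if x = b ! 0 then 1 else 0) + lev b"
  unfolding lev_def using assms by (subst card_Collect_nat_split) (auto simp: finite_Collect_Suc_less)

lemma all_nat_split: "(\<forall>k. P k) \<longleftrightarrow> P 0 \<and> (\<forall>k. P (Suc k))"
  by (metis not0_implies_Suc)

text \<open>Entries are compared only with those to their right, so prepending leaves the status of
  the tail entries unchanged.\<close>

lemma rlmin_Cons: "rlmin (x # b) = (if \<forall>y\<in>set b. x < y then 1 else 0) + rlmin b"
proof -
  have 1: "(\<forall>k. 0 < k \<and> k < length (x # b) \<longrightarrow> (x # b) ! 0 < (x # b) ! k) \<longleftrightarrow> (\<forall>y\<in>set b. x < y)"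
    unfolding all_set_conv_all_nth by (subst all_nat_split) simp
  have 2: "(\<forall>k. Suc i < k \<and> k < length (x # b) \<longrightarrow> (x # b) ! Suc i < (x # b) ! k) \<longleftrightarrow>
    (\<forall>k. i < k \<and> k < length b \<longrightarrow> b ! i < b ! k)" for i
    by (subst all_nat_split) simp
  let ?Q = "\<lambda>i. i < length (x # b) \<and> (\<forall>k. i < k \<and> k < length (x # b) \<longrightarrow> (x # b) ! i < (x # b) ! k)"
  have Q: "?Q (Suc i) \<longleftrightarrow> i < length b \<and> (\<forall>k. i < k \<and> k < length b \<longrightarrow> b ! i < b ! k)" for i
    unfolding 2 by simp
  have Q0: "?Q 0 \<longleftrightarrow> (\<forall>y\<in>set b. x < y)" unfolding 1 by simp
  show ?thesis unfolding rlmin_def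
    using card_Collect_nat_split[of ?Q] unfolding Q Q0 by simp
qed

text \<open>After prepending \<open>x\<close>, the entry \<open>b ! 0\<close> counts only by its
  truncated jump above \<open>x\<close> and no longer in full, hence the subtraction.\<close>

lemma exc_Cons:
  assumes "b \<noteq> []"
  shows "exc (x # b) = int x + max (int (b ! 0) - int x - 1) 0 + exc b - int (b ! 0)"
proof -
  have "(\<Sum>i = 1..<length (x # b). max (int ((x # b) ! i) - int ((x # b) ! (i - 1)) - 1) 0) =
    (\<Sum>i = 0..<length b. max (int (b ! i) - int ((x # b) ! i) - 1) 0)"
    using sum.shift_bounds_Suc_ivl[of "\<lambda>i. max (int ((x # b) ! i) - int ((x # b) ! (i - 1)) - 1) 0" 0 "length b"]
    by simp
  also have "\<dots> = max (int (b ! 0) - int x - 1) 0 +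
    (\<Sum>i = 1..<length b. max (int (b ! i) - int (b ! (i - 1)) - 1) 0)"
    using assms by (subst sum.atLeast_Suc_lessThan) (auto intro!: sum.cong simp: nth_Cons')
  finally show ?thesis by (simp add: exc_def)
qed

text \<open>Each step raises the sequence by at most 1 plus its truncated jump, and all jumps are
  part of \<open>exc\<close>. This bounds the entries once length and \<open>exc\<close> are
  fixed.\<close>

lemma nth_le_exc:
  assumes "i < length a"
  shows "int (a ! i) \<le> exc a + int i"
proof -
  let ?f = "\<lambda>i. max (int (a ! i) - int (a ! (i - 1)) - 1) 0"
  have "int (a ! i) \<le> int (a ! 0) + (\<Sum>k = 1..<Suc i. ?f k) + int i" if "i < length a"
    using that
  proof (induction i)
    case (Suc i)
    then have "int (a ! i) \<le> int (a ! 0) + (\<Sum>k = 1..<Suc i. ?f k) + int i" by simp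
    then show ?case by simp
  qed simp
  moreover have "(\<Sum>k = 1..<Suc i. ?f k) \<le> (\<Sum>k = 1..<length a. ?f k)"
    using assms by (intro sum_mono2) auto
  ultimately show ?thesis using assms by (simp add: exc_def)
qed

lemma finite_exc: "finite {a. length a = l \<and> exc a = r}"
proof (rule finite_subset)
  show "{a. length a = l \<and> exc a = r} \<subseteq> {a. set a \<subseteq> {..nat r + l} \<and> length a = l}"
  proof clarsimp
    fix x :: nat and a assume "x \<in> set a"
    then obtain i where "i < length a" "a ! i = x" by (auto simp: in_set_conv_nth)
    with nth_le_exc[of i a] show "x \<le> nat (exc a) + length a" by linarith
  qed
qed (simp add: finite_lists_length_eq)

section \<open>Polyominoes and their column heights\<close>

text \<open>A column with a successor needs two cells, since the successor starts one row higher and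
  has to share a row with it; the last column is exempt.\<close>

definition fib_heights :: "nat list \<Rightarrow> bool" where
  "fib_heights h \<longleftrightarrow> h \<noteq> [] \<and> (\<forall>i. Suc i < length h \<longrightarrow> 2 \<le> h ! i) \<and> 1 \<le> last h"

text \<open>The cell \<open>(u, v)\<close> is the bottom of the first column. Keeping the position
  as a parameter makes a translation class the family of all \<open>u\<close> and \<open>v\<close>
  for one fixed \<open>h\<close>.\<close>

definition staircase :: "int \<Rightarrow> int \<Rightarrow> nat list \<Rightarrow> cell set" where
  "staircase u v h = {(x, y). u \<le> x \<and> x < u + int (length h) \<and>
     v + (x - u) \<le> y \<and> y < v + (x - u) + int (h ! nat (x - u))}"

lemma mem_staircase: "(x, y) \<in> staircase u v h \<longleftrightarrow> u \<le> x \<and> x < u + int (length h) \<and>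
     v + (x - u) \<le> y \<and> y < v + (x - u) + int (h ! nat (x - u))"
  by (simp add: staircase_def)

lemma fib_heights_nth_ge_1:
  assumes "fib_heights h" "i < length h"
  shows "1 \<le> h ! i"
proof (cases "Suc i < length h")
  case True
  then have "2 \<le> h ! i" using assms by (simp add: fib_heights_def)
  then show ?thesis by simp
next
  case False
  then have "i = length h - 1" using assms(2) by simp
  then show ?thesis using assms by (auto simp: fib_heights_def last_conv_nth)
qed

section \<open>Columns and translates of a staircase\<close>

lemma column_staircase:
  "u \<le> x \<Longrightarrow> x < u + int (length h) \<Longrightarrow>
    column (staircase u v h) x = {v + (x - u)..<v + (x - u) + int (h ! nat (x - u))}"
  by (auto simp: column_def mem_staircase)

lemma fst_staircase:
  assumes "\<And>i. i < length h \<Longrightarrow> 1 \<le> h ! i"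
  shows "fst ` staircase u v h = {u..<u + int (length h)}"
proof -
  have "x \<in> fst ` staircase u v h" if "u \<le> x" "x < u + int (length h)" for x
  proof -
    have "nat (x - u) < length h" using that by auto
    from assms[OF this] that show ?thesis
      by (intro image_eqI[of _ _ "(x, v + (x - u))"]) (auto simp: mem_staircase)
  qed
  then show ?thesis by (auto simp: mem_staircase)
qed

lemma sorted_list_of_set_int_atLeastLessThan:
  "sorted_list_of_set {u..<u + int k} = map (\<lambda>i. u + int i) [0..<k]"
proof (rule sorted_distinct_set_unique)
  show "sorted (map (\<lambda>i. u + int i) [0..<k])"
    by (simp add: sorted_iff_nth_mono)
  have "x \<in> (\<lambda>i. u + int i) ` {0..<k}" if "x \<in> {u..<u + int k}" for x
    using that by (intro image_eqI[of _ _ "nat (x - u)"]) auto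
  then show "set (sorted_list_of_set {u..<u + int k}) = set (map (\<lambda>i. u + int i) [0..<k])"
    by auto
qed (auto simp: distinct_map inj_on_def)

lemma column_heights_staircase:
  assumes "\<And>i. i < length h \<Longrightarrow> 1 \<le> h ! i"
  shows "column_heights (staircase u v h) = h"
proof -
  have "fst ` staircase u v h = {u..<u + int (length h)}"
    using assms by (rule fst_staircase)
  then show ?thesis
    by (intro nth_equalityI)
      (auto simp: column_heights_def sorted_list_of_set_int_atLeastLessThan column_staircase)
qed

lemma translate_staircase:
  "(\<lambda>(x, y). (x + p, y + q)) ` staircase u v h = staircase (u + p) (v + q) h"
proof -
  have "(x, y) \<in> (\<lambda>(x, y). (x + p, y + q)) ` staircase u v h" if "(x, y) \<in> staircase (u + p) (v + q) h" for x y
    using that by (intro image_eqI[of _ _ "(x - p, y - q)"]) (auto simp: mem_staircase algebra_simps)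
  then show ?thesis by (auto simp: mem_staircase algebra_simps)
qed

lemma translation_class_staircase:
  "translation `` {staircase u v h} = {staircase p q h | p q. True}"
proof -
  have "staircase p q h = (\<lambda>(x, y). (x + (p - u), y + (q - v))) ` staircase u v h" for p q
    by (simp add: translate_staircase)
  then show ?thesis
    unfolding translation_def by (auto simp: translate_staircase Image_iff)
      (metis add.commute diff_add_cancel)
qed

text \<open>A path from column at most \<open>k\<close> to a column beyond \<open>k\<close> must at
  some step pass from \<open>k\<close> to \<open>k + 1\<close>, and that step is horizontal. This
  rules out empty columns in between and makes neighbouring columns share a row.\<close>

lemma polyomino_crossing:
  assumes "polyomino P" "c \<in> P" "c' \<in> P" "fst c \<le> k" "k < fst c'"
  shows "\<exists>y. (k, y) \<in> P \<and> (k + 1, y) \<in> P"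
proof -
  have "(c, c') \<in> {(a, b). a \<in> P \<and> b \<in> P \<and> adjacent a b}\<^sup>*"
    using assms unfolding polyomino_def by blast
  then show ?thesis using assms(5)
  proof (induction rule: rtrancl_induct)
    case base
    then show ?case using assms(4) by simp
  next
    case (step a b)
    show ?case
    proof (cases "k < fst a")
      case True
      then show ?thesis using step.IH by blast
    next
      case False
      with step have "fst a = k \<and> fst b = k + 1 \<and> snd a = snd b"
        by (auto simp: adjacent_def)
      then show ?thesis using step.hyps by (metis (no_types, lifting) case_prodD mem_Collect_eq prod.collapse)
    qed
  qed
qed

text \<open>The main point is connectivity: every cell is joined to the corner \<open>(u, v)\<close>
  by descending to the bottom of its column and then moving leftwards column by column.\<close>

lemma fibonacci_polyomino_staircase:
  assumes h: "fib_heights h"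
  shows "fibonacci_polyomino (staircase u v h)"
proof -
  let ?P = "staircase u v h"
  let ?R = "{(a, b). a \<in> ?P \<and> b \<in> ?P \<and> adjacent a b}"
  have fin: "finite ?P"
  proof (rule finite_subset)
    show "?P \<subseteq> Sigma {u..<u + int (length h)} (\<lambda>x. {v + (x - u)..<v + (x - u) + int (h ! nat (x - u))})"
      by (auto simp: mem_staircase)
  qed auto
  have ne: "(u, v) \<in> ?P"
    using h fib_heights_nth_ge_1[OF h, of 0] by (auto simp: mem_staircase fib_heights_def)
  have down: "((u + int i, v + int i + int k), (u + int i, v + int i)) \<in> ?R\<^sup>*"
    if "i < length h" "k < h ! i" for i k
    using that(2)
  proof (induction k)
    case (Suc k)
    then have "((u + int i, v + int i + int (Suc k)), (u + int i, v + int i + int k)) \<in> ?R"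
      using that(1) by (auto simp: mem_staircase adjacent_def)
    with Suc show ?case by (meson Suc_lessD converse_rtrancl_into_rtrancl)
  qed simp
  have left: "((u + int i, v + int i), (u, v)) \<in> ?R\<^sup>*" if "i < length h" for i
    using that
  proof (induction i)
    case (Suc i)
    \<comment> \<open>The left neighbour of the bottom cell of column \<open>i + 1\<close> is the
      second cell of column \<open>i\<close>; height at least 2 ensures that it exists.\<close>
    then have "2 \<le> h ! i" using h by (simp add: fib_heights_def)
    then have "((u + int (Suc i), v + int (Suc i)), (u + int i, v + int i + int 1)) \<in> ?R"
      using Suc.prems fib_heights_nth_ge_1[OF h, of "Suc i"]
      by (auto simp: mem_staircase adjacent_def nat_add_distrib)
    moreover have "((u + int i, v + int i + int 1), (u + int i, v + int i)) \<in> ?R\<^sup>*"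
      using Suc.prems \<open>2 \<le> h ! i\<close> by (intro down) auto
    ultimately show ?case using Suc
      by (meson Suc_lessD converse_rtrancl_into_rtrancl rtrancl_trans)
  qed simp
  have root: "(c, (u, v)) \<in> ?R\<^sup>*" if "c \<in> ?P" for c
  proof -
    obtain x y where c: "c = (x, y)" by (cases c)
    define i where "i = nat (x - u)"
    define k where "k = nat (y - v - int i)"
    have "c = (u + int i, v + int i + int k)" "i < length h" "k < h ! i"
      using that unfolding c i_def k_def by (auto simp: mem_staircase)
    with down left show ?thesis by (metis (no_types, lifting) rtrancl_trans)
  qed
  \<comment> \<open>Paths can be reversed, so any two cells are joined through the corner.\<close>
  have "sym ?R" by (auto simp: sym_def adjacent_def)
  then have "sym (?R\<^sup>*)" by (rule sym_rtrancl)
  then have "polyomino ?P"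
    unfolding polyomino_def using fin ne root
    by (metis (no_types, lifting) empty_iff rtrancl_trans symE)
  moreover have "column_convex ?P"
    unfolding column_convex_def by (auto simp: column_def mem_staircase)
  moreover have "Min (column ?P (x + 1)) = Min (column ?P x) + 1"
    if "column ?P x \<noteq> {}" "column ?P (x + 1) \<noteq> {}" for x
  proof -
    have M: "Min {a..<b} = a" if "a < b" for a b :: int
      using that by (intro Min_eqI) auto
    from that have "u \<le> x" "x + 1 < u + int (length h)" by (auto simp: column_def mem_staircase)
    with that show ?thesis by (simp add: column_staircase M)
  qed
  ultimately show ?thesis unfolding fibonacci_polyomino_def by blast
qed

lemma convex_int_set_eq:
  fixes C :: "int set"
  assumes "finite C" "C \<noteq> {}" "\<And>y y'. y \<in> C \<Longrightarrow> y' \<in> C \<Longrightarrow> {y..y'} \<subseteq> C"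
  shows "C = {Min C..<Min C + int (card C)}"
proof -
  define a b where "a = Min C" and "b = Max C"
  have "a \<le> b" using assms by (simp add: a_def b_def)
  moreover have "C = {a..b}"
    using assms(3)[of a b] assms(1,2) by (auto simp: a_def b_def)
  ultimately show ?thesis unfolding a_def[symmetric] by auto
qed

text \<open>Between the extreme columns \<open>u\<close> and \<open>w\<close> no column is empty, so
  the rule for bottom cells propagates from \<open>u\<close>; convexity then fixes each column by
  its bottom and its size.\<close>

lemma fibonacci_polyomino_obtains_staircase:
  assumes P: "fibonacci_polyomino P"
  obtains u v h where "fib_heights h" "P = staircase u v h"
proof -
  have poly: "polyomino P" and conv: "column_convex P"
    and step: "\<And>x. column P x \<noteq> {} \<Longrightarrow> column P (x + 1) \<noteq> {} \<Longrightarrow>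
      Min (column P (x + 1)) = Min (column P x) + 1"
    using P unfolding fibonacci_polyomino_def by auto
  have fin: "finite P" and ne: "P \<noteq> {}" using poly unfolding polyomino_def by auto
  define u where "u = Min (fst ` P)"
  define w where "w = Max (fst ` P)"
  define m where "m = nat (w - u + 1)"
  define v where "v = Min (column P u)"
  define h where "h = map (\<lambda>i. card (column P (u + int i))) [0..<m]"
  have u: "u \<in> fst ` P" and w: "w \<in> fst ` P" unfolding u_def w_def using fin ne by auto
  have bounds: "u \<le> x \<and> x \<le> w" if "x \<in> fst ` P" for x
    using that fin unfolding u_def w_def by simp
  have uw: "u \<le> w" using bounds u by blast
  then have len: "length h = m" "int m = w - u + 1" "m \<ge> 1" by (auto simp: h_def m_def)
  have cross: "\<exists>y. (x, y) \<in> P \<and> (x + 1, y) \<in> P" if "u \<le> x" "x < w" for x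
    using u w that by (auto intro: polyomino_crossing[OF poly])
  have nonempty: "column P x \<noteq> {}" if "u \<le> x" "x \<le> w" for x
    using cross[of x] w that by (cases "x = w") (auto simp: column_def)
  have finc: "finite (column P x)" for x
    by (rule finite_subset[of _ "snd ` P"]) (force simp: column_def fin)+
  have Mincol: "Min (column P (u + int i)) = v + int i" if "i < m" for i
    using that
  proof (induction i)
    case 0
    then show ?case by (simp add: v_def)
  next
    case (Suc i)
    then have "Min (column P (u + int i + 1)) = Min (column P (u + int i)) + 1"
      using len by (intro step nonempty) auto
    with Suc show ?case by (simp add: ac_simps)
  qed
  have hi: "h ! i = card (column P (u + int i))" if "i < m" for i
    using that by (simp add: h_def)
  have col: "column P (u + int i) = {v + int i..<v + int i + int (h ! i)}" if "i < m" for i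
    using convex_int_set_eq[OF finc nonempty, of "u + int i"] conv that len Mincol[OF that]
    by (simp add: column_convex_def hi)
  have "P = staircase u v h"
  proof (rule set_eqI, clarify)
    fix x y
    show "(x, y) \<in> P \<longleftrightarrow> (x, y) \<in> staircase u v h"
    proof (cases "u \<le> x \<and> x \<le> w")
      case True
      then have "nat (x - u) < m" using len by auto
      from col[OF this] True len show ?thesis
        by (auto simp: column_def mem_staircase set_eq_iff)
    next
      case False
      then show ?thesis using bounds[of x] len by (force simp: mem_staircase)
    qed
  qed
  moreover have "fib_heights h"
    unfolding fib_heights_def
  proof (intro conjI allI impI)
    show "h \<noteq> []" using len by auto
    have "card (column P w) \<ge> 1"
      using nonempty[of w] uw finc[of w] by (simp add: Suc_le_eq card_gt_0_iff)
    then show "1 \<le> last h"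
      using len \<open>h \<noteq> []\<close> by (simp add: last_conv_nth hi)
    \<comment> \<open>Some row \<open>y\<close> meets both columns. It is at least the bottom
      \<open>v + i + 1\<close> of the right one, hence lies above the bottom \<open>v + i\<close> of
      the left one.\<close>
    fix i assume i: "Suc i < length h"
    then obtain y where "(u + int i, y) \<in> P" "(u + int i + 1, y) \<in> P"
      using cross[of "u + int i"] len by auto
    then have "y \<in> column P (u + int i)" "y \<in> column P (u + int (Suc i))"
      by (auto simp: column_def ac_simps)
    with col[of i] col[of "Suc i"] i len show "2 \<le> h ! i" by auto
  qed
  ultimately show thesis using that by blast
qed

section \<open>Semiperimeters\<close>

lemma ex1_mem_pair_iff: "a \<noteq> b \<Longrightarrow> (\<exists>!c. c \<in> P \<and> (c = a \<or> c = b)) \<longleftrightarrow> (a \<in> P) \<noteq> (b \<in> P)"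
  by blast

text \<open>The edge named \<open>(x, y)\<close> separates the cells \<open>(x, y)\<close> and
  \<open>(x, y - 1)\<close>, so it is on the boundary exactly when membership changes between
  them.\<close>

lemma horizontal_boundary_eq:
  "{e. \<exists>!c. c \<in> P \<and> e \<in> horizontal_edges c} = {(x, y). ((x, y) \<in> P) \<noteq> ((x, y - 1) \<in> P)}"
proof -
  have "(x, y) \<in> horizontal_edges c \<longleftrightarrow> c = (x, y) \<or> c = (x, y - 1)" for x y c
    by (cases c) (auto simp: horizontal_edges_def)
  then have "(\<exists>!c. c \<in> P \<and> (x, y) \<in> horizontal_edges c) \<longleftrightarrow> ((x, y) \<in> P) \<noteq> ((x, y - 1) \<in> P)" for x y
    using ex1_mem_pair_iff[of "(x, y)" "(x, y - 1)" P] by simp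
  then show ?thesis by (simp add: set_eq_iff)
qed

lemma vertical_boundary_eq:
  "{e. \<exists>!c. c \<in> P \<and> e \<in> vertical_edges c} = {(x, y). ((x, y) \<in> P) \<noteq> ((x - 1, y) \<in> P)}"
proof -
  have "(x, y) \<in> vertical_edges c \<longleftrightarrow> c = (x, y) \<or> c = (x - 1, y)" for x y c
    by (cases c) (auto simp: vertical_edges_def)
  then have "(\<exists>!c. c \<in> P \<and> (x, y) \<in> vertical_edges c) \<longleftrightarrow> ((x, y) \<in> P) \<noteq> ((x - 1, y) \<in> P)" for x y
    using ex1_mem_pair_iff[of "(x, y)" "(x - 1, y)" P] by simp
  then show ?thesis by (simp add: set_eq_iff)
qed

text \<open>Every column is a nonempty interval and so has exactly two horizontal boundary edges,
  one below and one above.\<close>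

lemma horizontal_semiperimeter_staircase:
  assumes "fib_heights h"
  shows "horizontal_semiperimeter (staircase u v h) = of_nat (length h)"
proof -
  let ?X = "{u..<u + int (length h)}"
  let ?Y = "\<lambda>x. {v + (x - u), v + (x - u) + int (h ! nat (x - u))}"
  have pos: "0 < h ! nat (x - u)" if "x \<in> ?X" for x
  proof -
    have "nat (x - u) < length h" using that by auto
    from fib_heights_nth_ge_1[OF assms this] show ?thesis by simp
  qed
  have "{(x, y). ((x, y) \<in> staircase u v h) \<noteq> ((x, y - 1) \<in> staircase u v h)} = Sigma ?X ?Y"
    using pos by (auto simp: mem_staircase)
  moreover have "card (Sigma ?X ?Y) = (\<Sum>x\<in>?X. 2)"
    by (subst card_SigmaI) (use pos in \<open>auto intro!: sum.cong simp: card_insert_if\<close>)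
  ultimately show ?thesis
    unfolding horizontal_semiperimeter_def horizontal_boundary_eq by simp
qed

lemma vertical_semiperimeter_staircase:
  assumes "fib_heights h"
  shows "vertical_semiperimeter (staircase u v h) = of_int (exc (rev h) + int (length h) - 1)"
proof -
  define m where "m = length h"
  let ?P = "staircase u v h"
  let ?E = "{(x, y). ((x, y) \<in> ?P) \<noteq> ((x - 1, y) \<in> ?P)}"
  \<comment> \<open>The boundary edges are counted line by line: \<open>Y x\<close> holds the rows
    of those on the vertical line at \<open>x\<close>, for the \<open>m + 1\<close> lines from
    \<open>u\<close> to \<open>u + m\<close>.\<close>
  define Y where "Y x = {y. ((x, y) \<in> ?P) \<noteq> ((x - 1, y) \<in> ?P)}" for x
  have m: "m \<ge> 1" using assms by (cases h) (auto simp: m_def fib_heights_def)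
  have E: "?E = Sigma {u..u + int m} Y"
    by (auto simp: Y_def m_def mem_staircase)
  have Yu: "Y u = {v..<v + int (h ! 0)}"
    using m by (auto simp: Y_def mem_staircase m_def)
  have Ym: "Y (u + int m) = {v + int m - 1..<v + int m - 1 + int (h ! (m - 1))}"
    using m by (auto simp: Y_def mem_staircase m_def nat_diff_distrib')
  \<comment> \<open>This is the symmetric difference of two adjacent columns. They overlap, so it
    consists of the bottom row of the left column and the rows between the two tops.\<close>
  have Yi: "Y (u + int (Suc i)) = insert (v + int i)
      {min (v + int i + int (h ! i)) (v + int i + 1 + int (h ! Suc i))..<
       max (v + int i + int (h ! i)) (v + int i + 1 + int (h ! Suc i))}"
    if "Suc i < m" for i
  proof -
    have "2 \<le> h ! i" "1 \<le> h ! Suc i"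
      using assms that fib_heights_nth_ge_1[OF assms, of "Suc i"] by (auto simp: fib_heights_def m_def)
    then show ?thesis using that by (auto simp: Y_def mem_staircase m_def nat_add_distrib)
  qed
  \<comment> \<open>With \<open>x = h ! i - h ! Suc i - 1\<close> over the integers, the tops give
    \<open>2 * max x 0 - x\<close> rows and the bottom one more; the 1 inside \<open>- x\<close>
    raises the constant to 2.\<close>
  have cYi: "int (card (Y (u + int (Suc i)))) =
      2 * max (int (h ! i) - int (h ! Suc i) - 1) 0 - (int (h ! i) - int (h ! Suc i)) + 2"
    if "Suc i < m" for i
  proof -
    have "2 \<le> h ! i" "1 \<le> h ! Suc i"
      using assms that fib_heights_nth_ge_1[OF assms, of "Suc i"] by (auto simp: fib_heights_def m_def)
    then show ?thesis unfolding Yi[OF that] by (subst card_insert_disjoint) (auto simp: max_def min_def)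
  qed
  have finY: "finite (Y x)" if x: "x \<in> {u..u + int m}" for x
  proof -
    consider "x = u" | "x = u + int m" | i where "Suc i < m" "x = u + int (Suc i)"
    proof -
      assume *: "x = u \<Longrightarrow> thesis" "x = u + int m \<Longrightarrow> thesis"
        "\<And>i. Suc i < m \<Longrightarrow> x = u + int (Suc i) \<Longrightarrow> thesis"
      show thesis
      proof (cases "x = u \<or> x = u + int m")
        case False
        with x show thesis by (intro *(3)[of "nat (x - u) - 1"]) auto
      qed (use * in auto)
    qed
    then show ?thesis by cases (auto simp: Yu Ym Yi simp del: of_nat_Suc)
  qed
  have "int (card ?E) = (\<Sum>x\<in>{u..u + int m}. int (card (Y x)))"
    unfolding E by (subst card_SigmaI) (auto simp: finY)
  also have "\<dots> = (\<Sum>i\<in>{0..m}. int (card (Y (u + int i))))"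
    by (rule sum.reindex_bij_witness[of _ "\<lambda>i. u + int i" "\<lambda>x. nat (x - u)"]) auto
  also have "\<dots> = int (card (Y u)) + (\<Sum>i\<in>{0..<m}. int (card (Y (u + int (Suc i)))))"
    by (simp only: atLeast0AtMost atLeast0LessThan sum.atMost_shift) simp
  also have "(\<Sum>i\<in>{0..<m}. int (card (Y (u + int (Suc i))))) =
    (\<Sum>i<m - 1. int (card (Y (u + int (Suc i))))) + int (card (Y (u + int m)))"
    using m by (cases m) (auto simp: atLeast0LessThan)
  also have "(\<Sum>i<m - 1. int (card (Y (u + int (Suc i))))) =
    (\<Sum>i<m - 1. 2 * max (int (h ! i) - int (h ! Suc i) - 1) 0 - (int (h ! i) - int (h ! Suc i)) + 2)"
    by (intro sum.cong) (auto simp del: of_nat_Suc simp: cYi)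
  \<comment> \<open>The differences telescope to first minus last height. Adding the outer lines,
    which contribute the first and the last height, leaves twice the last height, as
    \<open>exc (rev h)\<close> requires.\<close>
  also have "\<dots> = 2 * (\<Sum>i<m - 1. max (int (h ! i) - int (h ! Suc i) - 1) 0)
      - (int (h ! 0) - int (h ! (m - 1))) + 2 * (int m - 1)"
    using m by (simp add: sum.distrib sum_subtractf sum_distrib_left[symmetric]
        sum_lessThan_telescope'[of "\<lambda>i. int (h ! i)", unfolded sum_subtractf] of_nat_diff)
  finally have "int (card ?E) = 2 * (exc (rev h) + int m - 1)"
    using m assms unfolding Yu Ym
    by (subst exc_rev) (auto simp: m_def last_conv_nth fib_heights_def)
  then have "(of_int (int (card ?E)) :: rat) = of_int (2 * (exc (rev h) + int m - 1))" by simp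
  then show ?thesis
    unfolding vertical_semiperimeter_def vertical_boundary_eq by (simp add: m_def)
qed

section \<open>Counting\<close>

text \<open>Sending \<open>h\<close> to the class of its staircases is a bijection:
  \<open>column_heights\<close> recovers \<open>h\<close> from any member, and every Fibonacci
  polyomino is a staircase.\<close>

lemma card_fibonacci_classes:
  "card ({P \<in> fibonacci_polyominoes m n. Q (column_heights P)} // translation) =
   card {h. fib_heights h \<and> length h = m \<and> exc (rev h) + int m - 1 = int n \<and> Q h}"
  (is "card (?A // _) = card ?H")
proof -
  let ?f = "\<lambda>h. {staircase p q h | p q. True}"
  have hs: "column_heights (staircase u v h) = h" if "fib_heights h" for u v h
    by (rule column_heights_staircase, rule fib_heights_nth_ge_1[OF that])
  \<comment> \<open>The right side does not mention \<open>u\<close> and \<open>v\<close>, so any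
    representative may be used to test a class.\<close>
  have mem: "staircase u v h \<in> ?A \<longleftrightarrow> h \<in> ?H" if "fib_heights h" for u v h
  proof -
    have "(of_int (exc (rev h) + int (length h) - 1) = (of_nat n :: rat)) \<longleftrightarrow>
        exc (rev h) + int (length h) - 1 = int n"
      by (metis of_int_eq_iff of_int_of_nat_eq)
    then show ?thesis using that unfolding fibonacci_polyominoes_def
      by (auto simp: hs fibonacci_polyomino_staircase horizontal_semiperimeter_staircase
          vertical_semiperimeter_staircase simp del: of_int_add of_int_diff)
  qed
  have inj: "inj_on ?f ?H"
  proof (rule inj_onI)
    fix h h' assume h: "h \<in> ?H" "h' \<in> ?H" "?f h = ?f h'"
    then have "staircase 0 0 h \<in> ?f h'" by blast
    then obtain p q where "staircase 0 0 h = staircase p q h'" by blast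
    with h hs show "h = h'" by (metis (mono_tags, lifting) mem_Collect_eq)
  qed
  have "?f ` ?H = ?A // translation"
  proof (intro equalityI subsetI)
    fix C assume "C \<in> ?f ` ?H"
    then obtain h where h: "h \<in> ?H" "C = ?f h" by blast
    then have "staircase 0 0 h \<in> ?A" using mem[of h 0 0] by simp
    then show "C \<in> ?A // translation"
      unfolding h(2) translation_class_staircase[of 0 0 h, symmetric] by (rule quotientI)
  next
    fix C assume "C \<in> ?A // translation"
    then obtain P where P: "P \<in> ?A" "C = translation `` {P}" by (rule quotientE)
    then have "fibonacci_polyomino P" by (simp add: fibonacci_polyominoes_def)
    then obtain u v h where h: "fib_heights h" "P = staircase u v h"
      by (rule fibonacci_polyomino_obtains_staircase)
    with P mem have "h \<in> ?H" by blast
    moreover have "C = ?f h" using P h by (simp add: translation_class_staircase)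
    ultimately show "C \<in> ?f ` ?H" by blast
  qed
  from this[symmetric] show ?thesis by (simp only: card_image[OF inj])
qed

text \<open>Reversal moves the exempt last column to the front, where it is the head of the
  list.\<close>

lemma fib_heights_rev:
  "fib_heights (rev a) \<longleftrightarrow> a \<noteq> [] \<and> 1 \<le> hd a \<and> (\<forall>x\<in>set (tl a). 2 \<le> x)"
proof (cases a)
  case (Cons x b)
  have "(\<forall>i. Suc i < length (rev a) \<longrightarrow> 2 \<le> rev a ! i) \<longleftrightarrow> (\<forall>y\<in>set (rev b). 2 \<le> y)"
    unfolding all_set_conv_all_nth Cons by (auto simp: nth_append)
  then show ?thesis unfolding fib_heights_def using Cons by (auto simp: last_rev)
qed (simp add: fib_heights_def)

lemma card_fib_heights_rev:
  "card {h. fib_heights h \<and> R (rev h)} = card {a. fib_heights (rev a) \<and> R a}"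
  by (rule bij_betw_same_card[of rev], rule bij_betw_byWitness[where f' = rev]) auto

lemma list_ge_2_obtains:
  assumes "\<forall>x\<in>set a. (2::nat) \<le> x"
  obtains b where "a = map (\<lambda>x. x + 2) b"
proof
  \<comment> \<open>Truncated subtraction loses nothing here because all entries are at least
    2.\<close>
  show "a = map (\<lambda>x. x + 2) (map (\<lambda>x. x - 2) a)"
    using assms by (auto simp: map_idI intro!: map_idI[symmetric])
qed

theorem theorem4p5:
  fixes m n d t j :: nat
  assumes "m \<ge> 2" and "n \<ge> 2" and "j \<ge> 1"
  shows "card ({P \<in> fibonacci_polyominoes m n. des (column_heights P) = d \<and>
             lmin (column_heights P) = j \<and> lev (column_heights P) = t} // translation)
         = S m (int n - int m - 1) (int d) (int j) (int t)
           + S (m - 1) (int n - int m) (int d - 1) (int j - 1) (int t)"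
proof -
  let ?R = "\<lambda>a. length a = m \<and> exc a + int m - 1 = int n \<and> asc a = d \<and> rlmin a = j \<and> lev a = t"
  let ?A = "{a. length a = m \<and> exc a = int n - int m - 1 \<and>
     int (asc a) = int d \<and> int (rlmin a) = int j \<and> int (lev a) = int t}"
  let ?B = "{a. length a = m - 1 \<and> exc a = int n - int m \<and>
     int (asc a) = int d - 1 \<and> int (rlmin a) = int j - 1 \<and> int (lev a) = int t}"
  let ?f = "map (\<lambda>x::nat. x + 2)" and ?g = "\<lambda>a. 1 # map (\<lambda>x::nat. x + 2) a"
  have "inj ?f" by (rule inj_mapI) (auto simp: inj_def)
  then have inj: "inj_on ?f ?A" "inj_on ?g ?B" by (auto simp: inj_on_def)
  have fin: "finite ?A" "finite ?B"
    using finite_subset[OF _ finite_exc[of m "int n - int m - 1"], of ?A]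
      finite_subset[OF _ finite_exc[of "m - 1" "int n - int m"], of ?B] by auto
  \<comment> \<open>Adding 2 raises \<open>exc\<close> from \<open>n - m - 1\<close> to the required
    \<open>n - m + 1\<close>. The list is nonempty because \<open>m\<close> is positive.\<close>
  have R_f: "?R (?f a) \<longleftrightarrow> a \<in> ?A" for a
    using assms(1) by (cases "a = []") (auto simp: asc_map_add lev_map_add rlmin_map_add exc_map_add
        simp del: add_2_eq_Suc')
  \<comment> \<open>The leading 1 is below all other entries, so it adds one ascent, one
    right-to-left minimum and no level. It lowers \<open>exc\<close> by 1 after the shift by 2, a
    net gain of 1 over \<open>n - m\<close>. Since \<open>m\<close> is at least 2, the tail is
    nonempty.\<close>
  have R_g: "?R (?g a) \<longleftrightarrow> a \<in> ?B" for a
    using assms(1)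
    by (cases "a = []")
      (auto simp: asc_Cons lev_Cons rlmin_Cons exc_Cons asc_map_add lev_map_add rlmin_map_add
        exc_map_add simp del: add_2_eq_Suc')
  have "{a. fib_heights (rev a) \<and> ?R a} = ?f ` ?A \<union> ?g ` ?B"
  proof (intro equalityI subsetI)
    fix a assume a: "a \<in> {a. fib_heights (rev a) \<and> ?R a}"
    show "a \<in> ?f ` ?A \<union> ?g ` ?B"
    proof (cases "\<forall>x\<in>set a. 2 \<le> x")
      case True
      then obtain b where b: "a = ?f b" by (rule list_ge_2_obtains)
      with a have "b \<in> ?A" using R_f[of b] by blast
      with b show ?thesis by blast
    next
      case False
      from a obtain x c where c: "a = x # c" "1 \<le> x" "\<forall>y\<in>set c. 2 \<le> y"
        by (cases a) (auto simp: fib_heights_rev)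
      with False have "x = 1" by auto
      obtain b where "c = ?f b" using c(3) by (rule list_ge_2_obtains)
      with c \<open>x = 1\<close> have b: "a = ?g b" by simp
      with a have "b \<in> ?B" using R_g[of b] by blast
      with b show ?thesis by blast
    qed
  next
    fix a assume "a \<in> ?f ` ?A \<union> ?g ` ?B"
    then show "a \<in> {a. fib_heights (rev a) \<and> ?R a}"
    proof
      assume "a \<in> ?f ` ?A"
      then obtain b where b: "a = ?f b" "b \<in> ?A" by blast
      then have "b \<noteq> []" using assms(1) by auto
      then have "fib_heights (rev a)" unfolding fib_heights_rev b(1) by (cases b) auto
      with b R_f[of b] show ?thesis by blast
    next
      assume "a \<in> ?g ` ?B"
      then obtain b where b: "a = ?g b" "b \<in> ?B" by blast
      then have "fib_heights (rev a)" unfolding fib_heights_rev b(1) by auto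
      with b R_g[of b] show ?thesis by blast
    qed
  qed
  \<comment> \<open>Lists of the second kind start with 1, those of the first have all entries at
    least 2.\<close>
  moreover have "?f ` ?A \<inter> ?g ` ?B = {}" by auto
  ultimately have "card {a. fib_heights (rev a) \<and> ?R a} = card ?A + card ?B"
    using inj fin by (simp add: card_Un_disjoint card_image)
  moreover have "card ({P \<in> fibonacci_polyominoes m n. des (column_heights P) = d \<and>
      lmin (column_heights P) = j \<and> lev (column_heights P) = t} // translation) =
      card {h. fib_heights h \<and> ?R (rev h)}"
    unfolding card_fibonacci_classes[where Q = "\<lambda>h. des h = d \<and> lmin h = j \<and> lev h = t"]
    by (simp add: asc_rev rlmin_rev lev_rev)
  ultimately show ?thesis
    unfolding S_def card_fib_heights_rev[where R = ?R] by linarith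
qed

end
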